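(* Let $E$, $F$ be locally convex spaces. (1) Let $A=[(A_\varepsilon)_\varepsilon]\subseteq\mathcal G_E$ and $B=[(B_\varepsilon)_\varepsilon]\subseteq\mathcal G_F$ be internal sets. Then $A\times B=[(A_\varepsilon\times B_\varepsilon)_\varepsilon]$ is an internal subset of $\mathcal G_E\times\mathcal G_F$. (2) Let $A=[(A_\varepsilon)_\varepsilon]\subseteq\mathcal G_E\times\mathcal G_F$ be internal. Then the projection $\mathrm{pr}_{\mathcal G_E}(A)$ of $A$ on $\mathcal G_E$ is a subset of $[(\mathrm{pr}_E(A_\varepsilon))_\varepsilon]$. If in addition $A$ has a sharply bounded representative, then $\mathrm{pr}_{\mathcal G_E}(A)=[(\mathrm{pr}_E(A_\varepsilon))_\varepsilon]$ is internal.
   Context: For a locally convex space $E$ with topology generated by seminorms $(p_i)_{i\in I}$: a net $(u_\varepsilon)_\varepsilon\in E^{(0,1)}$ is moderate if for each $i\in I$ there are $M\in\mathbb N$ and $\eta\in(0,1)$ with $p_i(u_\varepsilon)\le\varepsilon^{-M}$ for all $\varepsilon\le\eta$; it is negligible if for each $i\in I$ and each $m\in\mathbb N$ there is $\eta\in(0,1)$ with $p_i(u_\varepsilon)\le\varepsilon^m$ for all $\varepsilon\le\eta$. The Colombeau space based on $E$ is the quotient $\mathcal G_E$ of the moderate nets by the negligible nets; a net in the class $u\in\mathcal G_E$ is called a representative of $u$. A subset $A\subseteq\mathcal G_E$ is internal if there is a net $(A_\varepsilon)_{\varepsilon\in(0,1)}$ of subsets of $E$ (called a representative of $A$) such that $A=[(A_\varepsilon)_\varepsilon]$,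 the set of all $u\in\mathcal G_E$ for which there exist a representative $(u_\varepsilon)_\varepsilon$ of $u$ and $\eta>0$ such that $u_\varepsilon\in A_\varepsilon$ for all $\varepsilon<\eta$. A net $(A_\varepsilon)_\varepsilon$ of subsets of $E$ is sharply bounded if for each $i\in I$ there are $M\in\mathbb N$ and $\varepsilon_0\in(0,1)$ such that $p_i(u)\le\varepsilon^{-M}$ for all $\varepsilon\le\varepsilon_0$ and all $u\in A_\varepsilon$. If the topologies of $E$, $F$ are generated by $(p_i)_{i\in I}$, $(q_j)_{j\in J}$, then $E\times F$ is locally convex with seminorms $p_{ij}(u,v)=\max(p_i(u),q_j(v))$, and $\mathcal G_{E\times F}$ is identified with $\mathcal G_E\times\mathcal G_F$ through $[((u_\varepsilon,v_\varepsilon))_\varepsilon]\leftrightarrow([(u_\varepsilon)_\varepsilon],[(v_\varepsilon)_\varepsilon])$. Internal subsets of $\mathcal G_E\times\mathcal G_F$ and their representatives are understood via this identification. $\mathrm{pr}_{\mathcal G_E}$ and $\mathrm{pr}_E$ are the projections on the first factor.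
   Formalization: In (2), the equality pr(A)=[(pr_E(A_ε))_ε] is stated when (A_ε) is itself the sharply bounded representative; for another representative it can fail, e.g. A_ε={(1,0),(0,e^{1/ε})} in R×R. Seminorm families are taken nonempty. *)

theory Defs
  imports "HOL-Analysis.Analysis"
begin

text \<open>
  The scalars range over an arbitrary \<^class>\<open>real_normed_field\<close>, which covers the real and the
  complex numbers at once. The generating family of seminorms is part of the structure; it is
  required to be nonempty (the zero seminorm can always be adjoined), because otherwise the family
  \<open>p\<^sub>i\<^sub>j\<close> on a product would be empty as soon as one of the two families is. The space is not assumed
  to be Hausdorff.
\<close>

locale locally_convex_space = vector_space scale
  for scale :: "'k::real_normed_field \<Rightarrow> 'e::ab_group_add \<Rightarrow> 'e" +
  fixes T :: "'e topology"
    and I :: "'i set"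
    and p :: "'i \<Rightarrow> 'e \<Rightarrow> real"
  assumes index_nonempty: "I \<noteq> {}"
    and seminorm_scale: "i \<in> I \<Longrightarrow> p i (scale c x) = norm c * p i x"
    and seminorm_triangle: "i \<in> I \<Longrightarrow> p i (x + y) \<le> p i x + p i y"
    and generated_topology: "T = topology_generated_by {{y. p i (y - x) < r} | i x r. i \<in> I \<and> 0 < r}"

text \<open>
  A net in \<open>E\<^sup>(\<^sup>0\<^sup>,\<^sup>1\<^sup>)\<close> is a function on the reals of which only the values on \<open>(0,1)\<close> are ever
  inspected. Nets that agree on \<open>(0,1)\<close> differ by a negligible net, so the additional values
  disappear in the quotient. The same convention applies to nets of subsets.
\<close>

definition moderate_nets :: "'i set \<Rightarrow> ('i \<Rightarrow> 'e \<Rightarrow> real) \<Rightarrow> (real \<Rightarrow> 'e) set" where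
  "moderate_nets I p = {u. \<forall>i\<in>I. \<exists>M::nat. \<exists>\<eta>\<in>{0<..<1}. \<forall>\<epsilon>\<in>{0<..\<eta>}. p i (u \<epsilon>) \<le> 1 / \<epsilon> ^ M}"

definition negligible_nets :: "'i set \<Rightarrow> ('i \<Rightarrow> 'e \<Rightarrow> real) \<Rightarrow> (real \<Rightarrow> 'e) set" where
  "negligible_nets I p = {u. \<forall>i\<in>I. \<forall>m::nat. \<exists>\<eta>\<in>{0<..<1}. \<forall>\<epsilon>\<in>{0<..\<eta>}. p i (u \<epsilon>) \<le> \<epsilon> ^ m}"

definition colombeau_rel ::
  "'i set \<Rightarrow> ('i \<Rightarrow> 'e::ab_group_add \<Rightarrow> real) \<Rightarrow> ((real \<Rightarrow> 'e) \<times> (real \<Rightarrow> 'e)) set" where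
  "colombeau_rel I p =
     {(u, v). u \<in> moderate_nets I p \<and> v \<in> moderate_nets I p \<and> (\<lambda>\<epsilon>. u \<epsilon> - v \<epsilon>) \<in> negligible_nets I p}"

definition colombeau_space ::
  "'i set \<Rightarrow> ('i \<Rightarrow> 'e::ab_group_add \<Rightarrow> real) \<Rightarrow> (real \<Rightarrow> 'e) set set" where
  "colombeau_space I p = moderate_nets I p // colombeau_rel I p"

definition colombeau_class ::
  "'i set \<Rightarrow> ('i \<Rightarrow> 'e::ab_group_add \<Rightarrow> real) \<Rightarrow> (real \<Rightarrow> 'e) \<Rightarrow> (real \<Rightarrow> 'e) set" where
  "colombeau_class I p u = colombeau_rel I p `` {u}"

text \<open>The representatives of \<open>U \<in> \<G>\<^sub>E\<close> are exactly the elements of the equivalence class \<open>U\<close>.\<close>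

definition internal_set_of ::
  "'i set \<Rightarrow> ('i \<Rightarrow> 'e::ab_group_add \<Rightarrow> real) \<Rightarrow> (real \<Rightarrow> 'e set) \<Rightarrow> (real \<Rightarrow> 'e) set set" where
  "internal_set_of I p A =
     {U \<in> colombeau_space I p. \<exists>u\<in>U. \<exists>\<eta>>0. \<forall>\<epsilon>\<in>{0<..<1}. \<epsilon> < \<eta> \<longrightarrow> u \<epsilon> \<in> A \<epsilon>}"

definition is_internal ::
  "'i set \<Rightarrow> ('i \<Rightarrow> 'e::ab_group_add \<Rightarrow> real) \<Rightarrow> (real \<Rightarrow> 'e) set set \<Rightarrow> bool" where
  "is_internal I p S \<longleftrightarrow> (\<exists>A. S = internal_set_of I p A)"

definition sharply_bounded ::
  "'i set \<Rightarrow> ('i \<Rightarrow> 'e \<Rightarrow> real) \<Rightarrow> (real \<Rightarrow> 'e set) \<Rightarrow> bool" where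
  "sharply_bounded I p A \<longleftrightarrow>
     (\<forall>i\<in>I. \<exists>M::nat. \<exists>\<epsilon>\<^sub>0\<in>{0<..<1}. \<forall>\<epsilon>\<in>{0<..\<epsilon>\<^sub>0}. \<forall>u\<in>A \<epsilon>. p i u \<le> 1 / \<epsilon> ^ M)"

definition prod_seminorm ::
  "('i \<Rightarrow> 'e \<Rightarrow> real) \<Rightarrow> ('j \<Rightarrow> 'f \<Rightarrow> real) \<Rightarrow> 'i \<times> 'j \<Rightarrow> 'e \<times> 'f \<Rightarrow> real" where
  "prod_seminorm p q = (\<lambda>(i, j) (u, v). max (p i u) (q j v))"

text \<open>
  Being sharply bounded is a property of the representing net, not of the internal set it
  represents: adding points that no moderate net can hit leaves the internal set unchanged, but may
  enlarge the internal set represented by the projected net. An equality between the projection of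
  an internal set and the internal set of the projections therefore has to refer to a sharply
  bounded representative.
\<close>

text \<open>
  The identification of \<open>\<G>\<^sub>E\<^sub>\<times>\<^sub>F\<close> with \<open>\<G>\<^sub>E \<times> \<G>\<^sub>F\<close>. All representatives of a class yield
  the same pair of classes; see \<open>colombeau_prod_id_class\<close> and \<open>bij_betw_colombeau_prod_id\<close> below.
\<close>

definition colombeau_prod_id ::
  "'i set \<Rightarrow> ('i \<Rightarrow> 'e::ab_group_add \<Rightarrow> real) \<Rightarrow> 'j set \<Rightarrow> ('j \<Rightarrow> 'f::ab_group_add \<Rightarrow> real) \<Rightarrow>
   (real \<Rightarrow> 'e \<times> 'f) set \<Rightarrow> (real \<Rightarrow> 'e) set \<times> (real \<Rightarrow> 'f) set" where
  "colombeau_prod_id I p J q W =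
     the_elem ((\<lambda>w. (colombeau_class I p (fst \<circ> w), colombeau_class J q (snd \<circ> w))) ` W)"

definition prod_internal_set_of ::
  "'i set \<Rightarrow> ('i \<Rightarrow> 'e::ab_group_add \<Rightarrow> real) \<Rightarrow> 'j set \<Rightarrow> ('j \<Rightarrow> 'f::ab_group_add \<Rightarrow> real) \<Rightarrow>
   (real \<Rightarrow> ('e \<times> 'f) set) \<Rightarrow> ((real \<Rightarrow> 'e) set \<times> (real \<Rightarrow> 'f) set) set" where
  "prod_internal_set_of I p J q A =
     colombeau_prod_id I p J q ` internal_set_of (I \<times> J) (prod_seminorm p q) A"

definition is_prod_internal ::
  "'i set \<Rightarrow> ('i \<Rightarrow> 'e::ab_group_add \<Rightarrow> real) \<Rightarrow> 'j set \<Rightarrow> ('j \<Rightarrow> 'f::ab_group_add \<Rightarrow> real) \<Rightarrow>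
   ((real \<Rightarrow> 'e) set \<times> (real \<Rightarrow> 'f) set) set \<Rightarrow> bool" where
  "is_prod_internal I p J q S \<longleftrightarrow> (\<exists>A. S = prod_internal_set_of I p J q A)"

text \<open>
  Consistency of the definitions: the relation defining the quotient is an equivalence, \<open>E \<times> F\<close> with
  the seminorms \<open>p\<^sub>i\<^sub>j\<close> is locally convex for the product topology, and the identification is a
  well-defined bijection.
\<close>

context locally_convex_space
begin

lemma seminorm_zero: "i \<in> I \<Longrightarrow> p i 0 = 0"
  using seminorm_scale[of i 0 0] by simp

lemma seminorm_minus: "i \<in> I \<Longrightarrow> p i (x - y) = p i (y - x)"
  using seminorm_scale[of i "-1" "y - x"] by (simp add: scale_minus_left)

lemma seminorm_triangle_diff: "i \<in> I \<Longrightarrow> p i (x - z) \<le> p i (x - y) + p i (y - z)"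
  using seminorm_triangle[of i "x - y" "y - z"] by simp

lemma equiv_colombeau_rel: "equiv (moderate_nets I p) (colombeau_rel I p)"
proof (rule equivI)
  show "colombeau_rel I p \<subseteq> moderate_nets I p \<times> moderate_nets I p"
    by (auto simp: colombeau_rel_def)
  have "(\<lambda>_. 0) \<in> negligible_nets I p"
    unfolding negligible_nets_def mem_Collect_eq
    by (intro ballI allI bexI[of _ "1/2"]) (auto simp: seminorm_zero)
  then show "refl_on (moderate_nets I p) (colombeau_rel I p)"
    by (auto simp: refl_on_def colombeau_rel_def)
  show "sym (colombeau_rel I p)"
    by (auto simp: sym_def colombeau_rel_def negligible_nets_def seminorm_minus)
  show "trans (colombeau_rel I p)"
  proof (rule transI)
    fix u v w assume uv: "(u, v) \<in> colombeau_rel I p" and vw: "(v, w) \<in> colombeau_rel I p"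
    have "\<exists>\<eta>\<in>{0<..<1}. \<forall>\<epsilon>\<in>{0<..\<eta>}. p i (u \<epsilon> - w \<epsilon>) \<le> \<epsilon> ^ m" if i: "i \<in> I" for i m
    proof -
      obtain \<eta> where \<eta>: "\<eta> \<in> {0<..<1}" "\<forall>\<epsilon>\<in>{0<..\<eta>}. p i (u \<epsilon> - v \<epsilon>) \<le> \<epsilon> ^ Suc m"
        using uv i unfolding colombeau_rel_def negligible_nets_def by blast
      obtain \<xi> where \<xi>: "\<xi> \<in> {0<..<1}" "\<forall>\<epsilon>\<in>{0<..\<xi>}. p i (v \<epsilon> - w \<epsilon>) \<le> \<epsilon> ^ Suc m"
        using vw i unfolding colombeau_rel_def negligible_nets_def by blast
      have "p i (u \<epsilon> - w \<epsilon>) \<le> \<epsilon> ^ m" if "\<epsilon> \<in> {0<..min (min \<eta> \<xi>) (1/2)}" for \<epsilon>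
      proof -
        have "p i (u \<epsilon> - v \<epsilon>) \<le> \<epsilon> ^ Suc m" "p i (v \<epsilon> - w \<epsilon>) \<le> \<epsilon> ^ Suc m"
          using that \<eta>(2) \<xi>(2) by simp_all
        then have "p i (u \<epsilon> - w \<epsilon>) \<le> \<epsilon> ^ Suc m + \<epsilon> ^ Suc m"
          using seminorm_triangle_diff[OF i, of "u \<epsilon>" "w \<epsilon>" "v \<epsilon>"] by linarith
        also have "\<dots> = (2 * \<epsilon>) * \<epsilon> ^ m" by simp
        also have "\<dots> \<le> 1 * \<epsilon> ^ m" using that by (intro mult_right_mono) auto
        finally show ?thesis by simp
      qed
      then show ?thesis using \<eta>(1) \<xi>(1) by (intro bexI[of _ "min (min \<eta> \<xi>) (1/2)"]) auto
    qed
    then show "(u, w) \<in> colombeau_rel I p"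
      using uv vw by (auto simp: colombeau_rel_def negligible_nets_def)
  qed
qed

end

locale locally_convex_pair =
  E: locally_convex_space sE TE I p + F: locally_convex_space sF TF J q
  for sE :: "'k::real_normed_field \<Rightarrow> 'e::ab_group_add \<Rightarrow> 'e" and TE I and p :: "'i \<Rightarrow> 'e \<Rightarrow> real"
    and sF :: "'k \<Rightarrow> 'f::ab_group_add \<Rightarrow> 'f" and TF J and q :: "'j \<Rightarrow> 'f \<Rightarrow> real"
begin

sublocale vector_space_prod sE sF ..

lemma locally_convex_space_prod:
  "locally_convex_space scale (prod_topology TE TF) (I \<times> J) (prod_seminorm p q)"
proof
  show "I \<times> J \<noteq> {}" using E.index_nonempty F.index_nonempty by simp
  fix ij :: "'i \<times> 'j" and c and x y :: "'e \<times> 'f" assume ij: "ij \<in> I \<times> J"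
  show "prod_seminorm p q ij (scale c x) = norm c * prod_seminorm p q ij x"
    using ij by (auto simp: prod_seminorm_def scale_def E.seminorm_scale F.seminorm_scale
        max_mult_distrib_left split: prod.splits)
  show "prod_seminorm p q ij (x + y) \<le> prod_seminorm p q ij x + prod_seminorm p q ij y"
    using ij E.seminorm_triangle[of "fst ij" "fst x" "fst y"]
      F.seminorm_triangle[of "snd ij" "snd x" "snd y"]
    by (auto simp: prod_seminorm_def split: prod.splits)
next
  define G where "G = {{y. prod_seminorm p q ij (y - x) < r} | ij x r. ij \<in> I \<times> J \<and> 0 < r}"
  obtain i0 j0 where i0: "i0 \<in> I" and j0: "j0 \<in> J"
    using E.index_nonempty F.index_nonempty by blast
  have ball: "{y. prod_seminorm p q (i, j) (y - x) < r} =
      {y. p i (y - fst x) < r} \<times> {y. q j (y - snd x) < r}" for i j x r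
    by (auto simp: prod_seminorm_def case_prod_unfold)
  have open_E: "openin TE {y. p i (y - x) < r}" if "i \<in> I" "0 < r" for i x r
    unfolding E.generated_topology using that by (intro topology_generated_by_Basis) blast
  have open_F: "openin TF {y. q j (y - x) < r}" if "j \<in> J" "0 < r" for j x r
    unfolding F.generated_topology using that by (intro topology_generated_by_Basis) blast
  have open_G: "openin (topology_generated_by G)
      ({y. p i (y - fst x) < r} \<times> {y. q j (y - snd x) < r})" if "i \<in> I" "j \<in> J" "0 < r" for i j x r
    unfolding ball[symmetric] G_def using that by (intro topology_generated_by_Basis) blast
  have fst_open: "openin (topology_generated_by G) {w. p i (fst w - x) < r}"
    if "i \<in> I" "0 < r" for i x r
  proof -
    have "{w. p i (fst w - x) < r} =
        (\<Union>b. {y. p i (y - fst (x, b)) < r} \<times> {y. q j0 (y - snd (x, b)) < r})"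
      using that j0 F.seminorm_zero by auto (metis diff_self)
    then show ?thesis
      using open_G[OF that(1) j0 that(2)] by (auto intro!: openin_Union simp del: fst_conv snd_conv)
  qed
  have snd_open: "openin (topology_generated_by G) {w. q j (snd w - x) < r}"
    if "j \<in> J" "0 < r" for j x r
  proof -
    have "{w. q j (snd w - x) < r} =
        (\<Union>a. {y. p i0 (y - fst (a, x)) < r} \<times> {y. q j (y - snd (a, x)) < r})"
      using that i0 E.seminorm_zero by auto (metis diff_self)
    then show ?thesis
      using open_G[OF i0 that] by (auto intro!: openin_Union simp del: fst_conv snd_conv)
  qed
  have top_E: "topspace TE = UNIV"
  proof -
    have "x \<in> {y. p i0 (y - x) < 1}" for x using i0 by (simp add: E.seminorm_zero)
    then show ?thesis using open_E[OF i0 zero_less_one] openin_subset by blast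
  qed
  have top_F: "topspace TF = UNIV"
  proof -
    have "x \<in> {y. q j0 (y - x) < 1}" for x using j0 by (simp add: F.seminorm_zero)
    then show ?thesis using open_F[OF j0 zero_less_one] openin_subset by blast
  qed
  have top_G: "topspace (topology_generated_by G) = UNIV"
  proof -
    have "x \<in> {w. p i0 (fst w - fst x) < 1}" for x :: "'e \<times> 'f"
      using i0 by (simp add: E.seminorm_zero)
    then show ?thesis using fst_open[OF i0 zero_less_one] openin_subset by blast
  qed
  have "continuous_map (prod_topology TE TF) (topology_generated_by G) id"
  proof (rule continuous_on_generated_topo)
    fix U assume "U \<in> G"
    then obtain i j x r where "i \<in> I" "j \<in> J" "0 < r"
      "U = {y. p i (y - fst x) < r} \<times> {y. q j (y - snd x) < r}"
      by (auto simp: G_def ball)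
    then show "openin (prod_topology TE TF) (id -` U \<inter> topspace (prod_topology TE TF))"
      using open_E open_F by (simp add: openin_prod_Times_iff top_E top_F)
  next
    show "id ` topspace (prod_topology TE TF) \<subseteq> \<Union> G"
      using top_G unfolding topology_generated_by_topspace by simp
  qed
  moreover have "continuous_map (topology_generated_by G) (prod_topology TE TF) id"
  proof (rule continuous_map_pairwise[THEN iffD2], intro conjI)
    show "continuous_map (topology_generated_by G) TE (fst \<circ> id)"
      unfolding E.generated_topology
    proof (rule continuous_on_generated_topo)
      fix U assume "U \<in> {{y. p i (y - x) < r} |i x r. i \<in> I \<and> 0 < r}"
      then show "openin (topology_generated_by G)
          ((fst \<circ> id) -` U \<inter> topspace (topology_generated_by G))"
        using fst_open by (auto simp only: top_G vimage_def comp_def id_apply mem_Collect_eq Int_UNIV_right)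
    qed (use top_E in \<open>simp add: E.generated_topology\<close>)
    show "continuous_map (topology_generated_by G) TF (snd \<circ> id)"
      unfolding F.generated_topology
    proof (rule continuous_on_generated_topo)
      fix U assume "U \<in> {{y. q j (y - x) < r} |j x r. j \<in> J \<and> 0 < r}"
      then show "openin (topology_generated_by G)
          ((snd \<circ> id) -` U \<inter> topspace (topology_generated_by G))"
        using snd_open by (auto simp only: top_G vimage_def comp_def id_apply mem_Collect_eq Int_UNIV_right)
    qed (use top_F in \<open>simp add: F.generated_topology\<close>)
  qed
  moreover have "topspace (prod_topology TE TF) = topspace (topology_generated_by G)"
    by (simp only: top_G topspace_prod_topology top_E top_F UNIV_Times_UNIV)
  ultimately have "prod_topology TE TF = topology_generated_by G"
    by (metis topology_finer_continuous_id topology_eq)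
  then show "prod_topology TE TF =
      topology_generated_by {{y. prod_seminorm p q i (y - x) < r} |i x r. i \<in> I \<times> J \<and> 0 < r}"
    by (simp add: G_def)
qed

lemma moderate_prod_iff:
  "w \<in> moderate_nets (I \<times> J) (prod_seminorm p q) \<longleftrightarrow>
     fst \<circ> w \<in> moderate_nets I p \<and> snd \<circ> w \<in> moderate_nets J q"
proof (intro iffI conjI)
  assume w: "w \<in> moderate_nets (I \<times> J) (prod_seminorm p q)"
  show "fst \<circ> w \<in> moderate_nets I p"
    unfolding moderate_nets_def mem_Collect_eq
  proof
    fix i assume "i \<in> I"
    moreover obtain j where "j \<in> J" using F.index_nonempty by blast
    ultimately have "\<exists>M::nat. \<exists>\<eta>\<in>{0<..<1}. \<forall>\<epsilon>\<in>{0<..\<eta>}. prod_seminorm p q (i, j) (w \<epsilon>) \<le> 1 / \<epsilon> ^ M"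
      using w by (simp add: moderate_nets_def)
    then show "\<exists>M::nat. \<exists>\<eta>\<in>{0<..<1}. \<forall>\<epsilon>\<in>{0<..\<eta>}. p i ((fst \<circ> w) \<epsilon>) \<le> 1 / \<epsilon> ^ M"
      unfolding prod_seminorm_def case_prod_unfold by (simp, blast)
  qed
  show "snd \<circ> w \<in> moderate_nets J q"
    unfolding moderate_nets_def mem_Collect_eq
  proof
    fix j assume "j \<in> J"
    moreover obtain i where "i \<in> I" using E.index_nonempty by blast
    ultimately have "\<exists>M::nat. \<exists>\<eta>\<in>{0<..<1}. \<forall>\<epsilon>\<in>{0<..\<eta>}. prod_seminorm p q (i, j) (w \<epsilon>) \<le> 1 / \<epsilon> ^ M"
      using w by (simp add: moderate_nets_def)
    then show "\<exists>M::nat. \<exists>\<eta>\<in>{0<..<1}. \<forall>\<epsilon>\<in>{0<..\<eta>}. q j ((snd \<circ> w) \<epsilon>) \<le> 1 / \<epsilon> ^ M"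
      unfolding prod_seminorm_def case_prod_unfold by (simp, blast)
  qed
next
  assume w: "fst \<circ> w \<in> moderate_nets I p \<and> snd \<circ> w \<in> moderate_nets J q"
  have "\<exists>M::nat. \<exists>\<eta>\<in>{0<..<1}. \<forall>\<epsilon>\<in>{0<..\<eta>}. prod_seminorm p q (i, j) (w \<epsilon>) \<le> 1 / \<epsilon> ^ M"
    if ij: "i \<in> I" "j \<in> J" for i j
  proof -
    obtain M \<eta> where M: "\<eta> \<in> {0<..<1}" "\<forall>\<epsilon>\<in>{0<..\<eta>}. p i (fst (w \<epsilon>)) \<le> 1 / \<epsilon> ^ M"
      using w ij unfolding moderate_nets_def mem_Collect_eq comp_def by metis
    obtain N \<xi> where N: "\<xi> \<in> {0<..<1}" "\<forall>\<epsilon>\<in>{0<..\<xi>}. q j (snd (w \<epsilon>)) \<le> 1 / \<epsilon> ^ N"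
      using w ij unfolding moderate_nets_def mem_Collect_eq comp_def by metis
    have "prod_seminorm p q (i, j) (w \<epsilon>) \<le> 1 / \<epsilon> ^ max M N" if "\<epsilon> \<in> {0<..min \<eta> \<xi>}" for \<epsilon>
    proof -
      have \<epsilon>: "0 < \<epsilon>" "\<epsilon> \<le> 1" using that M(1) by auto
      have "1 / \<epsilon> ^ M \<le> 1 / \<epsilon> ^ max M N" "1 / \<epsilon> ^ N \<le> 1 / \<epsilon> ^ max M N"
        using \<epsilon> by (auto intro!: divide_left_mono power_decreasing)
      moreover have "p i (fst (w \<epsilon>)) \<le> 1 / \<epsilon> ^ M" "q j (snd (w \<epsilon>)) \<le> 1 / \<epsilon> ^ N"
        using M(2) N(2) that by auto
      ultimately show ?thesis by (simp add: prod_seminorm_def case_prod_unfold)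
    qed
    then show ?thesis using M(1) N(1)
      by (intro exI[of _ "max M N"] bexI[of _ "min \<eta> \<xi>"]) auto
  qed
  then show "w \<in> moderate_nets (I \<times> J) (prod_seminorm p q)" by (auto simp: moderate_nets_def)
qed

lemma negligible_prod_iff:
  "w \<in> negligible_nets (I \<times> J) (prod_seminorm p q) \<longleftrightarrow>
     fst \<circ> w \<in> negligible_nets I p \<and> snd \<circ> w \<in> negligible_nets J q"
proof (intro iffI conjI)
  assume w: "w \<in> negligible_nets (I \<times> J) (prod_seminorm p q)"
  show "fst \<circ> w \<in> negligible_nets I p"
    unfolding negligible_nets_def mem_Collect_eq
  proof
    fix i assume "i \<in> I"
    moreover obtain j where "j \<in> J" using F.index_nonempty by blast
    ultimately have "\<forall>m::nat. \<exists>\<eta>\<in>{0<..<1}. \<forall>\<epsilon>\<in>{0<..\<eta>}. prod_seminorm p q (i, j) (w \<epsilon>) \<le> \<epsilon> ^ m"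
      using w by (simp add: negligible_nets_def)
    then show "\<forall>m::nat. \<exists>\<eta>\<in>{0<..<1}. \<forall>\<epsilon>\<in>{0<..\<eta>}. p i ((fst \<circ> w) \<epsilon>) \<le> \<epsilon> ^ m"
      unfolding prod_seminorm_def case_prod_unfold by (simp, blast)
  qed
  show "snd \<circ> w \<in> negligible_nets J q"
    unfolding negligible_nets_def mem_Collect_eq
  proof
    fix j assume "j \<in> J"
    moreover obtain i where "i \<in> I" using E.index_nonempty by blast
    ultimately have "\<forall>m::nat. \<exists>\<eta>\<in>{0<..<1}. \<forall>\<epsilon>\<in>{0<..\<eta>}. prod_seminorm p q (i, j) (w \<epsilon>) \<le> \<epsilon> ^ m"
      using w by (simp add: negligible_nets_def)
    then show "\<forall>m::nat. \<exists>\<eta>\<in>{0<..<1}. \<forall>\<epsilon>\<in>{0<..\<eta>}. q j ((snd \<circ> w) \<epsilon>) \<le> \<epsilon> ^ m"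
      unfolding prod_seminorm_def case_prod_unfold by (simp, blast)
  qed
next
  assume w: "fst \<circ> w \<in> negligible_nets I p \<and> snd \<circ> w \<in> negligible_nets J q"
  have "\<exists>\<eta>\<in>{0<..<1}. \<forall>\<epsilon>\<in>{0<..\<eta>}. prod_seminorm p q (i, j) (w \<epsilon>) \<le> \<epsilon> ^ m"
    if ij: "i \<in> I" "j \<in> J" for i j m
  proof -
    obtain \<eta> where M: "\<eta> \<in> {0<..<1}" "\<forall>\<epsilon>\<in>{0<..\<eta>}. p i (fst (w \<epsilon>)) \<le> \<epsilon> ^ m"
      using w ij unfolding negligible_nets_def mem_Collect_eq comp_def by metis
    obtain \<xi> where N: "\<xi> \<in> {0<..<1}" "\<forall>\<epsilon>\<in>{0<..\<xi>}. q j (snd (w \<epsilon>)) \<le> \<epsilon> ^ m"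
      using w ij unfolding negligible_nets_def mem_Collect_eq comp_def by metis
    show ?thesis using M N
      by (intro bexI[of _ "min \<eta> \<xi>"]) (auto simp: prod_seminorm_def case_prod_unfold)
  qed
  then show "w \<in> negligible_nets (I \<times> J) (prod_seminorm p q)" by (auto simp: negligible_nets_def)
qed

lemma colombeau_rel_prod_iff:
  "(v, w) \<in> colombeau_rel (I \<times> J) (prod_seminorm p q) \<longleftrightarrow>
     (fst \<circ> v, fst \<circ> w) \<in> colombeau_rel I p \<and> (snd \<circ> v, snd \<circ> w) \<in> colombeau_rel J q"
proof -
  have "fst \<circ> (\<lambda>\<epsilon>. v \<epsilon> - w \<epsilon>) = (\<lambda>\<epsilon>. (fst \<circ> v) \<epsilon> - (fst \<circ> w) \<epsilon>)"
    "snd \<circ> (\<lambda>\<epsilon>. v \<epsilon> - w \<epsilon>) = (\<lambda>\<epsilon>. (snd \<circ> v) \<epsilon> - (snd \<circ> w) \<epsilon>)"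
    by (simp_all add: fun_eq_iff)
  then show ?thesis
    by (simp only: colombeau_rel_def mem_Collect_eq prod.case moderate_prod_iff negligible_prod_iff)
      blast
qed

lemma equiv_colombeau_rel_prod:
  "equiv (moderate_nets (I \<times> J) (prod_seminorm p q)) (colombeau_rel (I \<times> J) (prod_seminorm p q))"
  using locally_convex_space.equiv_colombeau_rel[OF locally_convex_space_prod] .

lemma colombeau_prod_id_class:
  assumes "w \<in> moderate_nets (I \<times> J) (prod_seminorm p q)"
  shows "colombeau_prod_id I p J q (colombeau_class (I \<times> J) (prod_seminorm p q) w) =
    (colombeau_class I p (fst \<circ> w), colombeau_class J q (snd \<circ> w))"
proof -
  have "(\<lambda>v. (colombeau_class I p (fst \<circ> v), colombeau_class J q (snd \<circ> v))) `
      colombeau_class (I \<times> J) (prod_seminorm p q) w =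
      {(colombeau_class I p (fst \<circ> w), colombeau_class J q (snd \<circ> w))}"
  proof -
    have "(colombeau_class I p (fst \<circ> v), colombeau_class J q (snd \<circ> v)) =
        (colombeau_class I p (fst \<circ> w), colombeau_class J q (snd \<circ> w))"
      if "v \<in> colombeau_class (I \<times> J) (prod_seminorm p q) w" for v
    proof -
      have "(w, v) \<in> colombeau_rel (I \<times> J) (prod_seminorm p q)"
        using that by (simp add: colombeau_class_def)
      then have "(fst \<circ> w, fst \<circ> v) \<in> colombeau_rel I p" "(snd \<circ> w, snd \<circ> v) \<in> colombeau_rel J q"
        by (simp_all add: colombeau_rel_prod_iff)
      from equiv_class_eq[OF E.equiv_colombeau_rel this(1)]
        equiv_class_eq[OF F.equiv_colombeau_rel this(2)]
      show ?thesis by (simp add: colombeau_class_def)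
    qed
    moreover have "w \<in> colombeau_class (I \<times> J) (prod_seminorm p q) w"
      using equiv_class_self[OF equiv_colombeau_rel_prod assms] by (simp add: colombeau_class_def)
    ultimately show ?thesis by blast
  qed
  then show ?thesis by (simp add: colombeau_prod_id_def)
qed

lemma bij_betw_colombeau_prod_id:
  "bij_betw (colombeau_prod_id I p J q)
     (colombeau_space (I \<times> J) (prod_seminorm p q)) (colombeau_space I p \<times> colombeau_space J q)"
proof (rule bij_betw_imageI)
  show "inj_on (colombeau_prod_id I p J q) (colombeau_space (I \<times> J) (prod_seminorm p q))"
  proof (rule inj_onI)
    fix V W
    assume "V \<in> colombeau_space (I \<times> J) (prod_seminorm p q)"
      and "W \<in> colombeau_space (I \<times> J) (prod_seminorm p q)"
    then obtain v w
      where v: "v \<in> moderate_nets (I \<times> J) (prod_seminorm p q)"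
          "V = colombeau_class (I \<times> J) (prod_seminorm p q) v"
        and w: "w \<in> moderate_nets (I \<times> J) (prod_seminorm p q)"
          "W = colombeau_class (I \<times> J) (prod_seminorm p q) w"
      by (auto simp: colombeau_space_def colombeau_class_def elim!: quotientE)
    assume "colombeau_prod_id I p J q V = colombeau_prod_id I p J q W"
    then have "colombeau_class I p (fst \<circ> v) = colombeau_class I p (fst \<circ> w)"
      "colombeau_class J q (snd \<circ> v) = colombeau_class J q (snd \<circ> w)"
      by (simp_all add: v w colombeau_prod_id_class)
    then have "(v, w) \<in> colombeau_rel (I \<times> J) (prod_seminorm p q)"
      unfolding colombeau_rel_prod_iff colombeau_class_def
      using v(1) w(1) eq_equiv_class[OF _ E.equiv_colombeau_rel]
        eq_equiv_class[OF _ F.equiv_colombeau_rel] by (auto simp: moderate_prod_iff)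
    then show "V = W"
      unfolding v(2) w(2) colombeau_class_def by (rule equiv_class_eq[OF equiv_colombeau_rel_prod])
  qed
  show "colombeau_prod_id I p J q ` colombeau_space (I \<times> J) (prod_seminorm p q) =
      colombeau_space I p \<times> colombeau_space J q"
  proof (intro equalityI subsetI)
    fix X assume "X \<in> colombeau_prod_id I p J q ` colombeau_space (I \<times> J) (prod_seminorm p q)"
    then obtain w where "w \<in> moderate_nets (I \<times> J) (prod_seminorm p q)"
      "X = colombeau_prod_id I p J q (colombeau_class (I \<times> J) (prod_seminorm p q) w)"
      by (auto simp: colombeau_space_def colombeau_class_def elim!: quotientE)
    then show "X \<in> colombeau_space I p \<times> colombeau_space J q"
      by (simp add: colombeau_prod_id_class moderate_prod_iff)
         (simp add: colombeau_space_def colombeau_class_def quotientI)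
  next
    fix X assume "X \<in> colombeau_space I p \<times> colombeau_space J q"
    then obtain u v where uv: "u \<in> moderate_nets I p" "v \<in> moderate_nets J q"
      "X = (colombeau_class I p u, colombeau_class J q v)"
      by (auto simp: colombeau_space_def colombeau_class_def elim!: quotientE)
    define w where "w = (\<lambda>\<epsilon>. (u \<epsilon>, v \<epsilon>))"
    have "fst \<circ> w = u" "snd \<circ> w = v" by (auto simp: w_def)
    with uv have w: "w \<in> moderate_nets (I \<times> J) (prod_seminorm p q)"
      "X = colombeau_prod_id I p J q (colombeau_class (I \<times> J) (prod_seminorm p q) w)"
      by (simp_all add: moderate_prod_iff colombeau_prod_id_class)
    then show "X \<in> colombeau_prod_id I p J q ` colombeau_space (I \<times> J) (prod_seminorm p q)"
      by (auto simp: colombeau_space_def colombeau_class_def intro!: imageI quotientI)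
  qed
qed

end

end

theory Submission
  imports Defs
begin

text \<open>
  Both parts become statements about representing nets. A class lies in an internal set
  \<open>[(A\<^sub>\<epsilon>)\<^sub>\<epsilon>]\<close> iff it is the class of a moderate net \<open>u\<close> with \<open>u\<^sub>\<epsilon> \<in> A\<^sub>\<epsilon>\<close> for all small \<open>\<epsilon>\<close>
  (\<open>internal_set_of_eq_image\<close>), and under the identification of \<open>\<G>\<^sub>E\<^sub>\<times>\<^sub>F\<close> with \<open>\<G>\<^sub>E \<times> \<G>\<^sub>F\<close> such a
  net splits into its two components (\<open>mem_prod_internal_set_of_iff\<close>). For a product of nets of sets
  the condition on the pair splits as well: a property holds for small \<open>\<epsilon>\<close> on both components
  exactly when it holds for small \<open>\<epsilon>\<close> on each of them. Likewise the first component of a net that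
  runs in \<open>(A\<^sub>\<epsilon>)\<^sub>\<epsilon>\<close> runs in the projections, which is the inclusion.

  For the reverse inclusion, let \<open>u\<close> be a moderate net with \<open>u\<^sub>\<epsilon> \<in> pr\<^sub>E(A\<^sub>\<epsilon>)\<close> for small \<open>\<epsilon>\<close>.
  Choosing for each such \<open>\<epsilon>\<close> a point \<open>v\<^sub>\<epsilon>\<close> of the fibre over \<open>u\<^sub>\<epsilon>\<close> gives a net
  \<open>(u\<^sub>\<epsilon>, v\<^sub>\<epsilon>)\<close> in \<open>(A\<^sub>\<epsilon>)\<^sub>\<epsilon>\<close>. In general the choice can grow too fast to define an element of
  \<open>\<G>\<^sub>F\<close>, but sharp boundedness makes every net in \<open>(A\<^sub>\<epsilon>)\<^sub>\<epsilon>\<close> moderate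
  (\<open>sharply_bounded_selection_moderate\<close>), so the class of \<open>u\<close> lifts to \<open>A\<close>.
\<close>

lemma eventually_at_right_zero_unit_iff:
  "eventually P (at_right (0::real)) \<longleftrightarrow> (\<exists>\<eta>>0. \<forall>\<epsilon>\<in>{0<..<1}. \<epsilon> < \<eta> \<longrightarrow> P \<epsilon>)"
proof
  assume "eventually P (at_right 0)"
  then show "\<exists>\<eta>>0. \<forall>\<epsilon>\<in>{0<..<1}. \<epsilon> < \<eta> \<longrightarrow> P \<epsilon>"
    by (auto simp: eventually_at_right_field)
next
  assume "\<exists>\<eta>>0. \<forall>\<epsilon>\<in>{0<..<1}. \<epsilon> < \<eta> \<longrightarrow> P \<epsilon>"
  then obtain \<eta> where "0 < \<eta>" "\<forall>\<epsilon>\<in>{0<..<1}. \<epsilon> < \<eta> \<longrightarrow> P \<epsilon>" by blast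
  then show "eventually P (at_right 0)"
    by (auto simp: eventually_at_right_field intro!: exI[of _ "min \<eta> 1"])
qed

text \<open>
  The exponent in a sharp bound depends on the seminorm but not on the point of \<open>A \<epsilon>\<close>, so it
  serves every selection at once, however wildly the selected points vary with \<open>\<epsilon>\<close>.
\<close>

lemma sharply_bounded_selection_moderate:
  assumes bounded: "sharply_bounded I p A"
    and selection: "\<forall>\<^sub>F \<epsilon> in at_right 0. u \<epsilon> \<in> A \<epsilon>"
  shows "u \<in> moderate_nets I p"
  unfolding moderate_nets_def mem_Collect_eq
proof
  fix i assume "i \<in> I"
  then obtain M :: nat and \<epsilon>\<^sub>0
    where \<epsilon>\<^sub>0: "\<epsilon>\<^sub>0 \<in> {0<..<1}" and M: "\<forall>\<epsilon>\<in>{0<..\<epsilon>\<^sub>0}. \<forall>u\<in>A \<epsilon>. p i u \<le> 1 / \<epsilon> ^ M"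
    using bounded unfolding sharply_bounded_def by blast
  obtain b where b: "0 < b" "\<And>\<epsilon>. 0 < \<epsilon> \<Longrightarrow> \<epsilon> < b \<Longrightarrow> u \<epsilon> \<in> A \<epsilon>"
    using selection by (auto simp: eventually_at_right_field)
  have "\<forall>\<epsilon>\<in>{0<..min \<epsilon>\<^sub>0 (b / 2)}. p i (u \<epsilon>) \<le> 1 / \<epsilon> ^ M"
    using M b by auto
  moreover have "min \<epsilon>\<^sub>0 (b / 2) \<in> {0<..<1}" using \<epsilon>\<^sub>0 b(1) by auto
  ultimately show "\<exists>M::nat. \<exists>\<eta>\<in>{0<..<1}. \<forall>\<epsilon>\<in>{0<..\<eta>}. p i (u \<epsilon>) \<le> 1 / \<epsilon> ^ M" by blast
qed

text \<open>
  A class is the class of each of its representatives, in particular of one that runs in the sets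
  \<open>A \<epsilon>\<close>. Presenting internal sets as images lets the later arguments choose nets and leave the
  quotient aside.
\<close>

lemma (in locally_convex_space) internal_set_of_eq_image:
  "internal_set_of I p A =
     colombeau_class I p ` {u \<in> moderate_nets I p. \<forall>\<^sub>F \<epsilon> in at_right 0. u \<epsilon> \<in> A \<epsilon>}"
proof (intro equalityI subsetI)
  fix U assume "U \<in> internal_set_of I p A"
  then obtain u where U: "U \<in> moderate_nets I p // colombeau_rel I p" and u: "u \<in> U"
    and A: "\<forall>\<^sub>F \<epsilon> in at_right 0. u \<epsilon> \<in> A \<epsilon>"
    by (auto simp: internal_set_of_def colombeau_space_def eventually_at_right_zero_unit_iff)
  have "u \<in> moderate_nets I p"
    using U u in_quotient_imp_subset[OF equiv_colombeau_rel] by blast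
  moreover have "U = colombeau_class I p u"
    using equiv_colombeau_rel U u unfolding colombeau_class_def
    by (metis Image_singleton_iff equiv_class_eq quotientE)
  ultimately show
    "U \<in> colombeau_class I p ` {u \<in> moderate_nets I p. \<forall>\<^sub>F \<epsilon> in at_right 0. u \<epsilon> \<in> A \<epsilon>}"
    using A by blast
next
  fix U
  assume "U \<in> colombeau_class I p ` {u \<in> moderate_nets I p. \<forall>\<^sub>F \<epsilon> in at_right 0. u \<epsilon> \<in> A \<epsilon>}"
  then obtain u where u: "u \<in> moderate_nets I p" and A: "\<forall>\<^sub>F \<epsilon> in at_right 0. u \<epsilon> \<in> A \<epsilon>"
    and U: "U = colombeau_class I p u" by blast
  have "U \<in> colombeau_space I p"
    unfolding U colombeau_class_def colombeau_space_def using u by (rule quotientI)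
  moreover have "u \<in> U"
    unfolding U colombeau_class_def using equiv_colombeau_rel u by (rule equiv_class_self)
  ultimately show "U \<in> internal_set_of I p A"
    using A by (auto simp: internal_set_of_def eventually_at_right_zero_unit_iff)
qed

context locally_convex_pair
begin

text \<open>
  A net in \<open>E \<times> F\<close> is moderate iff both components are, and the identification sends its class to the
  classes of the components; so the pairs in question are parametrised by pairs of moderate nets.
\<close>

lemma mem_prod_internal_set_of_iff:
  "X \<in> prod_internal_set_of I p J q A \<longleftrightarrow>
     (\<exists>u v. u \<in> moderate_nets I p \<and> v \<in> moderate_nets J q \<and>
        (\<forall>\<^sub>F \<epsilon> in at_right 0. (u \<epsilon>, v \<epsilon>) \<in> A \<epsilon>) \<and>
        X = (colombeau_class I p u, colombeau_class J q v))"
proof -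
  interpret P: locally_convex_space scale "prod_topology TE TF" "I \<times> J" "prod_seminorm p q"
    by (rule locally_convex_space_prod)
  have "X \<in> prod_internal_set_of I p J q A \<longleftrightarrow>
      (\<exists>w\<in>moderate_nets (I \<times> J) (prod_seminorm p q). (\<forall>\<^sub>F \<epsilon> in at_right 0. w \<epsilon> \<in> A \<epsilon>) \<and>
         X = (colombeau_class I p (fst \<circ> w), colombeau_class J q (snd \<circ> w)))"
    unfolding prod_internal_set_of_def P.internal_set_of_eq_image
    by (auto simp: image_iff colombeau_prod_id_class)
  also have "\<dots> \<longleftrightarrow>
     (\<exists>u v. u \<in> moderate_nets I p \<and> v \<in> moderate_nets J q \<and>
        (\<forall>\<^sub>F \<epsilon> in at_right 0. (u \<epsilon>, v \<epsilon>) \<in> A \<epsilon>) \<and>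
        X = (colombeau_class I p u, colombeau_class J q v))" (is "_ \<longleftrightarrow> ?R")
  proof
    assume "\<exists>w\<in>moderate_nets (I \<times> J) (prod_seminorm p q). (\<forall>\<^sub>F \<epsilon> in at_right 0. w \<epsilon> \<in> A \<epsilon>) \<and>
       X = (colombeau_class I p (fst \<circ> w), colombeau_class J q (snd \<circ> w))"
    then obtain w where "w \<in> moderate_nets (I \<times> J) (prod_seminorm p q)"
      "\<forall>\<^sub>F \<epsilon> in at_right 0. w \<epsilon> \<in> A \<epsilon>"
      "X = (colombeau_class I p (fst \<circ> w), colombeau_class J q (snd \<circ> w))" by blast
    then show ?R
      by (intro exI[of _ "fst \<circ> w"] exI[of _ "snd \<circ> w"]) (simp add: moderate_prod_iff)
  next
    assume ?R
    then obtain u v where uv: "u \<in> moderate_nets I p" "v \<in> moderate_nets J q"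
      "\<forall>\<^sub>F \<epsilon> in at_right 0. (u \<epsilon>, v \<epsilon>) \<in> A \<epsilon>"
      "X = (colombeau_class I p u, colombeau_class J q v)" by blast
    have "fst \<circ> (\<lambda>\<epsilon>. (u \<epsilon>, v \<epsilon>)) = u" "snd \<circ> (\<lambda>\<epsilon>. (u \<epsilon>, v \<epsilon>)) = v" by auto
    with uv show "\<exists>w\<in>moderate_nets (I \<times> J) (prod_seminorm p q).
        (\<forall>\<^sub>F \<epsilon> in at_right 0. w \<epsilon> \<in> A \<epsilon>) \<and>
        X = (colombeau_class I p (fst \<circ> w), colombeau_class J q (snd \<circ> w))"
      by (intro bexI[of _ "\<lambda>\<epsilon>. (u \<epsilon>, v \<epsilon>)"]) (simp_all add: moderate_prod_iff)
  qed
  finally show ?thesis .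
qed

lemma prod_internal_set_of_Times:
  "prod_internal_set_of I p J q (\<lambda>\<epsilon>. A \<epsilon> \<times> B \<epsilon>) = internal_set_of I p A \<times> internal_set_of J q B"
  by (auto simp: set_eq_iff mem_prod_internal_set_of_iff E.internal_set_of_eq_image
      F.internal_set_of_eq_image eventually_conj_iff image_iff; blast)

lemma fst_prod_internal_set_of_subset:
  "fst ` prod_internal_set_of I p J q A \<subseteq> internal_set_of I p (\<lambda>\<epsilon>. fst ` A \<epsilon>)"
proof
  fix U assume "U \<in> fst ` prod_internal_set_of I p J q A"
  then obtain u v where u: "u \<in> moderate_nets I p" "U = colombeau_class I p u"
    and A: "\<forall>\<^sub>F \<epsilon> in at_right 0. (u \<epsilon>, v \<epsilon>) \<in> A \<epsilon>"
    by (auto simp: mem_prod_internal_set_of_iff)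
  from A have "\<forall>\<^sub>F \<epsilon> in at_right 0. u \<epsilon> \<in> fst ` A \<epsilon>"
    by eventually_elim force
  with u show "U \<in> internal_set_of I p (\<lambda>\<epsilon>. fst ` A \<epsilon>)"
    by (auto simp: E.internal_set_of_eq_image)
qed

text \<open>
  Sharp boundedness is applied to the pair of \<open>u\<close> and a pointwise choice of fibre points, which
  is a selection of \<open>A\<close>; this makes the chosen second component moderate.
\<close>

lemma fst_prod_internal_set_of_eq:
  assumes bounded: "sharply_bounded (I \<times> J) (prod_seminorm p q) A"
  shows "fst ` prod_internal_set_of I p J q A = internal_set_of I p (\<lambda>\<epsilon>. fst ` A \<epsilon>)"
proof (rule equalityI[OF fst_prod_internal_set_of_subset], rule subsetI)
  fix U assume "U \<in> internal_set_of I p (\<lambda>\<epsilon>. fst ` A \<epsilon>)"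
  then obtain u where u: "u \<in> moderate_nets I p" "U = colombeau_class I p u"
    and A: "\<forall>\<^sub>F \<epsilon> in at_right 0. u \<epsilon> \<in> fst ` A \<epsilon>"
    by (auto simp: E.internal_set_of_eq_image)
  \<comment> \<open>The fibre over \<open>u \<epsilon>\<close> can be empty, leaving \<open>v \<epsilon>\<close> unspecified, but not for small \<open>\<epsilon>\<close>,
     and moderateness depends only on small \<open>\<epsilon>\<close>.\<close>
  define v where "v = (\<lambda>\<epsilon>. SOME y. (u \<epsilon>, y) \<in> A \<epsilon>)"
  from A have uv: "\<forall>\<^sub>F \<epsilon> in at_right 0. (u \<epsilon>, v \<epsilon>) \<in> A \<epsilon>"
    by eventually_elim (auto simp: v_def intro: someI)
  have "(\<lambda>\<epsilon>. (u \<epsilon>, v \<epsilon>)) \<in> moderate_nets (I \<times> J) (prod_seminorm p q)"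
    using bounded uv by (rule sharply_bounded_selection_moderate)
  then have "v \<in> moderate_nets J q"
    by (simp add: moderate_prod_iff comp_def)
  with u uv have "(U, colombeau_class J q v) \<in> prod_internal_set_of I p J q A"
    by (auto simp: mem_prod_internal_set_of_iff)
  then show "U \<in> fst ` prod_internal_set_of I p J q A"
    by (rule rev_image_eqI) simp
qed

end

theorem theorem3p11:
  fixes sE :: "'k::real_normed_field \<Rightarrow> 'e::ab_group_add \<Rightarrow> 'e"
    and TE :: "'e topology" and I :: "'i set" and p :: "'i \<Rightarrow> 'e \<Rightarrow> real"
    and sF :: "'k \<Rightarrow> 'f::ab_group_add \<Rightarrow> 'f"
    and TF :: "'f topology" and J :: "'j set" and q :: "'j \<Rightarrow> 'f \<Rightarrow> real"
  assumes "locally_convex_space sE TE I p"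
    and "locally_convex_space sF TF J q"
  shows
    "(\<forall>A B A' B'.
        A = internal_set_of I p A' \<and> B = internal_set_of J q B' \<longrightarrow>
          A \<times> B = prod_internal_set_of I p J q (\<lambda>\<epsilon>. A' \<epsilon> \<times> B' \<epsilon>) \<and>
          is_prod_internal I p J q (A \<times> B)) \<and>
     (\<forall>A A'.
        A = prod_internal_set_of I p J q A' \<longrightarrow>
          fst ` A \<subseteq> internal_set_of I p (\<lambda>\<epsilon>. fst ` A' \<epsilon>) \<and>
          (sharply_bounded (I \<times> J) (prod_seminorm p q) A' \<longrightarrow>
             fst ` A = internal_set_of I p (\<lambda>\<epsilon>. fst ` A' \<epsilon>)) \<and>
          ((\<exists>C. A = prod_internal_set_of I p J q C \<and>
                sharply_bounded (I \<times> J) (prod_seminorm p q) C) \<longrightarrow>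
             is_internal I p (fst ` A)))"
proof -
  interpret locally_convex_pair sE TE I p sF TF J q
    using assms by (simp add: locally_convex_pair_def)
  show ?thesis
  proof (intro conjI allI impI)
    fix A B A' B'
    assume "A = internal_set_of I p A' \<and> B = internal_set_of J q B'"
    then show *: "A \<times> B = prod_internal_set_of I p J q (\<lambda>\<epsilon>. A' \<epsilon> \<times> B' \<epsilon>)"
      by (simp add: prod_internal_set_of_Times)
    show "is_prod_internal I p J q (A \<times> B)"
      unfolding is_prod_internal_def using * by blast
  next
    fix A A'
    assume "A = prod_internal_set_of I p J q A'"
    then show "fst ` A \<subseteq> internal_set_of I p (\<lambda>\<epsilon>. fst ` A' \<epsilon>)"
      using fst_prod_internal_set_of_subset by simp
  next
    fix A A'
    assume "A = prod_internal_set_of I p J q A'"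
      and "sharply_bounded (I \<times> J) (prod_seminorm p q) A'"
    then show "fst ` A = internal_set_of I p (\<lambda>\<epsilon>. fst ` A' \<epsilon>)"
      using fst_prod_internal_set_of_eq by simp
  next
    fix A
    assume "\<exists>C. A = prod_internal_set_of I p J q C \<and>
      sharply_bounded (I \<times> J) (prod_seminorm p q) C"
    then show "is_internal I p (fst ` A)"
      unfolding is_internal_def using fst_prod_internal_set_of_eq by metis
  qed
qed

end
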